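(* Let $T,\sigma,\sigma_0,\gamma,c,\beta>0$ and $\mu_0\in\mathbb R$ be constants. Consider the free-boundary problem for $h=h(t,y,z)$ on $[0,T]\times\mathbb R\times[0,\infty)$: $$\begin{cases} h_t+\frac1{\sigma^2}\big(h_z+\frac12h_{yy}\big)=0,&\text{if } h_z+\frac12h_{yy}+\frac12h_y^2+c\gamma>0,\\ h_t+\big(\frac1{\sigma^2}+\beta^2\big)\big(h_z+\frac12h_{yy}\big)+\frac{\beta^2}2h_y^2+\beta^2c\gamma=0,&\text{if } h_z+\frac12h_{yy}+\frac12h_y^2+c\gamma\le0,\\ h(T,y,z)=-\frac12\log(z\sigma_0^2+1)+\frac{y^2\sigma_0^2+2y\mu_0-z\mu_0^2}{2(z\sigma_0^2+1)}.\end{cases}$$ This problem admits a classical solution $h\in C^{1,2,1}([0,T]\times\mathbb R\times[0,\infty))$, given by $$h(t,y,z)=P(t,z)+H(t,z)\Big[\mu_0y+\frac12\sigma_0^2y^2\Big],$$ where $$P(t,z)=\begin{cases}\frac12\log H(t,z)-\frac{H(t,z)}2\Big[\mu_0^2z+\frac{\mu_0^2-\sigma_0^2}{\sigma^2}(T-t)\Big],& z\in[\delta(t)\vee0,\infty),\\[2mm] P(t_1,\delta(t_1))+\beta^2c\gamma(t_1-t)-\frac{\mu_0^2}{2\sigma_0^2}\big[H(t_1,\delta(t_1))-H(t,z)\big]\\ \quad-\frac{\beta^2+\frac1{\sigma^2}}{2\beta^2}\big[\log H(t_1,\delta(t_1))-\log H(t,z)\big],& z\in[0,\delta(t)\vee0),\end{cases}$$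 the free boundary is $$z=\delta(t)=-\frac{T-t}{\sigma^2}-\frac1{\sigma_0^2}+\sqrt{\frac{T-t}{2c\sigma^2\gamma}},$$ and, when $\delta(t)>0$ (and $0\le z<\delta(t)$), $t_1=t_1(t,z)$ is the unique non-negative solution of $$\Big(\frac1{\sigma^2}+\beta^2\Big)(t_1-t)+z=-\frac{T-t_1}{\sigma^2}-\frac1{\sigma_0^2}+\sqrt{\frac{T-t_1}{2c\sigma^2\gamma}}.$$
   Context: $H(t,z)=\dfrac{1}{\sigma_0^2z+\frac{\sigma_0^2}{\sigma^2}(T-t)+1}$ for $(t,z)\in[0,T]\times(-\frac1{\sigma_0^2},\infty)$. $C^{1,2,1}$ means once continuously differentiable in $t$, twice in $y$, once in $z$. $a\vee b=\max\{a,b\}$. *)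

theory Defs
  imports "HOL-Analysis.Analysis"
begin

definition fb_domain :: "real \<Rightarrow> (real \<times> real \<times> real) set" where
  "fb_domain T = {0..T} \<times> UNIV \<times> {0..}"

text \<open>Partial derivatives of a function of \<open>(t, y, z)\<close> on \<open>fb_domain T\<close>; they are one-sided at
  \<open>t = 0\<close>, \<open>t = T\<close> and \<open>z = 0\<close>.\<close>

definition pd_t :: "real \<Rightarrow> (real \<Rightarrow> real \<Rightarrow> real \<Rightarrow> real) \<Rightarrow> real \<Rightarrow> real \<Rightarrow> real \<Rightarrow> real" where
  "pd_t T h t y z = vector_derivative (\<lambda>s. h s y z) (at t within {0..T})"

definition pd_y :: "(real \<Rightarrow> real \<Rightarrow> real \<Rightarrow> real) \<Rightarrow> real \<Rightarrow> real \<Rightarrow> real \<Rightarrow> real" where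
  "pd_y h t y z = vector_derivative (\<lambda>w. h t w z) (at y)"

definition pd_z :: "(real \<Rightarrow> real \<Rightarrow> real \<Rightarrow> real) \<Rightarrow> real \<Rightarrow> real \<Rightarrow> real \<Rightarrow> real" where
  "pd_z h t y z = vector_derivative (\<lambda>w. h t y w) (at z within {0..})"

definition C121 :: "real \<Rightarrow> (real \<Rightarrow> real \<Rightarrow> real \<Rightarrow> real) \<Rightarrow> bool" where
  "C121 T h \<longleftrightarrow>
     (\<forall>(t, y, z) \<in> fb_domain T.
        (\<lambda>s. h s y z) differentiable (at t within {0..T}) \<and>
        (\<lambda>w. h t w z) differentiable (at y) \<and>
        (\<lambda>w. pd_y h t w z) differentiable (at y) \<and>
        (\<lambda>w. h t y w) differentiable (at z within {0..})) \<and>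
     continuous_on (fb_domain T) (\<lambda>(t, y, z). h t y z) \<and>
     continuous_on (fb_domain T) (\<lambda>(t, y, z). pd_t T h t y z) \<and>
     continuous_on (fb_domain T) (\<lambda>(t, y, z). pd_y h t y z) \<and>
     continuous_on (fb_domain T) (\<lambda>(t, y, z). pd_y (pd_y h) t y z) \<and>
     continuous_on (fb_domain T) (\<lambda>(t, y, z). pd_z h t y z)"

definition switch_fun ::
  "real \<Rightarrow> real \<Rightarrow> (real \<Rightarrow> real \<Rightarrow> real \<Rightarrow> real) \<Rightarrow> real \<Rightarrow> real \<Rightarrow> real \<Rightarrow> real" where
  "switch_fun \<gamma> c h t y z =
     pd_z h t y z + 1/2 * pd_y (pd_y h) t y z + 1/2 * (pd_y h t y z)\<^sup>2 + c * \<gamma>"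

definition classical_solution ::
  "real \<Rightarrow> real \<Rightarrow> real \<Rightarrow> real \<Rightarrow> real \<Rightarrow> real \<Rightarrow> real \<Rightarrow>
   (real \<Rightarrow> real \<Rightarrow> real \<Rightarrow> real) \<Rightarrow> bool" where
  "classical_solution T \<sigma> \<sigma>0 \<mu>0 \<gamma> c \<beta> h \<longleftrightarrow>
     C121 T h \<and>
     (\<forall>(t, y, z) \<in> fb_domain T.
        (switch_fun \<gamma> c h t y z > 0 \<longrightarrow>
           pd_t T h t y z + 1 / \<sigma>\<^sup>2 * (pd_z h t y z + 1/2 * pd_y (pd_y h) t y z) = 0) \<and>
        (switch_fun \<gamma> c h t y z \<le> 0 \<longrightarrow>
           pd_t T h t y z + (1 / \<sigma>\<^sup>2 + \<beta>\<^sup>2) * (pd_z h t y z + 1/2 * pd_y (pd_y h) t y z)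
             + \<beta>\<^sup>2 / 2 * (pd_y h t y z)\<^sup>2 + \<beta>\<^sup>2 * c * \<gamma> = 0)) \<and>
     (\<forall>y. \<forall>z \<ge> 0. h T y z =
        - 1/2 * ln (z * \<sigma>0\<^sup>2 + 1)
        + (y\<^sup>2 * \<sigma>0\<^sup>2 + 2 * y * \<mu>0 - z * \<mu>0\<^sup>2) / (2 * (z * \<sigma>0\<^sup>2 + 1)))"

text \<open>The common boundary of the two regions in which the two equations are imposed. As
  \<open>fb_domain T\<close> is closed and is the union of the two regions, this is their topological boundary
  relative to \<open>fb_domain T\<close>.\<close>

definition free_boundary ::
  "real \<Rightarrow> real \<Rightarrow> real \<Rightarrow> (real \<Rightarrow> real \<Rightarrow> real \<Rightarrow> real) \<Rightarrow> (real \<times> real \<times> real) set" where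
  "free_boundary T \<gamma> c h =
     closure {(t, y, z) \<in> fb_domain T. switch_fun \<gamma> c h t y z > 0} \<inter>
     closure {(t, y, z) \<in> fb_domain T. switch_fun \<gamma> c h t y z \<le> 0}"

definition H_fun :: "real \<Rightarrow> real \<Rightarrow> real \<Rightarrow> real \<Rightarrow> real \<Rightarrow> real" where
  "H_fun T \<sigma> \<sigma>0 t z = 1 / (\<sigma>0\<^sup>2 * z + \<sigma>0\<^sup>2 / \<sigma>\<^sup>2 * (T - t) + 1)"

definition delta :: "real \<Rightarrow> real \<Rightarrow> real \<Rightarrow> real \<Rightarrow> real \<Rightarrow> real \<Rightarrow> real" where
  "delta T \<sigma> \<sigma>0 \<gamma> c t =
     - (T - t) / \<sigma>\<^sup>2 - 1 / \<sigma>0\<^sup>2 + sqrt ((T - t) / (2 * c * \<sigma>\<^sup>2 * \<gamma>))"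

text \<open>The bound \<open>s \<le> T\<close> only says that the square root in the equation is meaningful (in HOL,
  \<open>sqrt\<close> is also defined, as an odd function, on the negative reals).\<close>

definition is_t1 ::
  "real \<Rightarrow> real \<Rightarrow> real \<Rightarrow> real \<Rightarrow> real \<Rightarrow> real \<Rightarrow> real \<Rightarrow> real \<Rightarrow> real \<Rightarrow> bool" where
  "is_t1 T \<sigma> \<sigma>0 \<gamma> c \<beta> t z s \<longleftrightarrow>
     0 \<le> s \<and> s \<le> T \<and>
     (1 / \<sigma>\<^sup>2 + \<beta>\<^sup>2) * (s - t) + z =
       - (T - s) / \<sigma>\<^sup>2 - 1 / \<sigma>0\<^sup>2 + sqrt ((T - s) / (2 * c * \<sigma>\<^sup>2 * \<gamma>))"

definition t1_fun ::
  "real \<Rightarrow> real \<Rightarrow> real \<Rightarrow> real \<Rightarrow> real \<Rightarrow> real \<Rightarrow> real \<Rightarrow> real \<Rightarrow> real" where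
  "t1_fun T \<sigma> \<sigma>0 \<gamma> c \<beta> t z = (THE s. is_t1 T \<sigma> \<sigma>0 \<gamma> c \<beta> t z s)"

definition P_upper :: "real \<Rightarrow> real \<Rightarrow> real \<Rightarrow> real \<Rightarrow> real \<Rightarrow> real \<Rightarrow> real" where
  "P_upper T \<sigma> \<sigma>0 \<mu>0 t z =
     1/2 * ln (H_fun T \<sigma> \<sigma>0 t z)
     - H_fun T \<sigma> \<sigma>0 t z / 2 * (\<mu>0\<^sup>2 * z + (\<mu>0\<^sup>2 - \<sigma>0\<^sup>2) / \<sigma>\<^sup>2 * (T - t))"

text \<open>In the lower branch the value \<open>P(t1, \<delta>(t1))\<close> lies on the free boundary, hence is given by the
  upper branch; using \<open>P_upper\<close> there avoids a recursive definition.\<close>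

definition P_fun ::
  "real \<Rightarrow> real \<Rightarrow> real \<Rightarrow> real \<Rightarrow> real \<Rightarrow> real \<Rightarrow> real \<Rightarrow> real \<Rightarrow> real \<Rightarrow> real" where
  "P_fun T \<sigma> \<sigma>0 \<mu>0 \<gamma> c \<beta> t z =
     (if max (delta T \<sigma> \<sigma>0 \<gamma> c t) 0 \<le> z then P_upper T \<sigma> \<sigma>0 \<mu>0 t z
      else let t1 = t1_fun T \<sigma> \<sigma>0 \<gamma> c \<beta> t z;
               d1 = delta T \<sigma> \<sigma>0 \<gamma> c t1
           in P_upper T \<sigma> \<sigma>0 \<mu>0 t1 d1 + \<beta>\<^sup>2 * c * \<gamma> * (t1 - t)
              - \<mu>0\<^sup>2 / (2 * \<sigma>0\<^sup>2) * (H_fun T \<sigma> \<sigma>0 t1 d1 - H_fun T \<sigma> \<sigma>0 t z)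
              - (\<beta>\<^sup>2 + 1 / \<sigma>\<^sup>2) / (2 * \<beta>\<^sup>2)
                * (ln (H_fun T \<sigma> \<sigma>0 t1 d1) - ln (H_fun T \<sigma> \<sigma>0 t z)))"

definition h_fun ::
  "real \<Rightarrow> real \<Rightarrow> real \<Rightarrow> real \<Rightarrow> real \<Rightarrow> real \<Rightarrow> real \<Rightarrow> real \<Rightarrow> real \<Rightarrow> real \<Rightarrow> real" where
  "h_fun T \<sigma> \<sigma>0 \<mu>0 \<gamma> c \<beta> t y z =
     P_fun T \<sigma> \<sigma>0 \<mu>0 \<gamma> c \<beta> t z
     + H_fun T \<sigma> \<sigma>0 t z * (\<mu>0 * y + 1/2 * \<sigma>0\<^sup>2 * y\<^sup>2)"

end

theory Submission
  imports Defs
begin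

text \<open>In the coordinate \<open>w = z + (T - t) / \<sigma>\<^sup>2 + 1 / \<sigma>0\<^sup>2\<close>, for which \<open>H = 1 / (\<sigma>0\<^sup>2 w)\<close>, the
  solution becomes \<open>h = const + (\<mu>0 + \<sigma>0\<^sup>2 y)\<^sup>2 / (2 \<sigma>0\<^sup>4 w) + G(t, z)\<close>, the switching function no
  longer depends on \<open>y\<close>, and the free boundary is a parabola \<open>\<beta>\<^sup>2 (T - t) = \<kappa> w\<^sup>2\<close>. Below it, the
  value \<open>u\<close> of \<open>w\<close> at the point where the characteristic through \<open>(t, z)\<close> hits the boundary is the
  positive root of \<open>u + \<kappa> u\<^sup>2 = w + \<beta>\<^sup>2 (T - t)\<close>, and \<open>T - t1 = \<kappa> u\<^sup>2 / \<beta>\<^sup>2\<close>. Hence both branches of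
  \<open>G\<close> are explicit functions of \<open>t\<close>, \<open>w\<close> and \<open>u\<close>, the region below the boundary is \<open>w < u\<close>, and on
  the boundary \<open>u = w\<close> the branches agree together with their first derivatives. The switching
  function equals \<open>c \<gamma> - (T - t) / (2 \<sigma>\<^sup>2 w\<^sup>2)\<close> above and \<open>(1 / u - 1 / w) / (2 \<sigma>\<^sup>2 \<beta>\<^sup>2)\<close> below the
  boundary, which gives its sign.\<close>

section \<open>Gluing two functions along the zeros of a continuous function\<close>

text \<open>Where \<open>e x\<close> is nonzero, continuity fixes the sign of \<open>e\<close>
  nearby and a single piece decides. At a zero of \<open>e\<close> the pieces share value and slope,
  so the difference quotient of the glued function switches between two quotients with the same
  limit.\<close>

lemma has_field_derivative_glue:
  fixes f1 f2 :: "'a::real_normed_field \<Rightarrow> 'a" and e :: "'a \<Rightarrow> real"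
  assumes f1: "(f1 has_field_derivative D1) (at x within S)"
    and f2: "(f2 has_field_derivative D2) (at x within S)"
    and e: "continuous (at x within S) e"
    and eq: "e x = 0 \<Longrightarrow> f1 x = f2 x \<and> D1 = D2"
  shows "((\<lambda>s. if 0 \<le> e s then f1 s else f2 s) has_field_derivative
          (if 0 \<le> e x then D1 else D2)) (at x within S)"
    (is "(?f has_field_derivative _) _")
proof -
  have lim: "(e \<longlongrightarrow> e x) (at x within S)"
    using e by (simp add: continuous_within)
  consider "e x > 0" | "e x < 0" | "e x = 0" by linarith
  then show ?thesis
  proof cases
    case 1
    have "eventually (\<lambda>s. f1 s = ?f s) (at x within S)"
      using order_tendstoD(1)[OF lim 1] by eventually_elim simp
    then have "(?f has_field_derivative D1) (at x within S)"
      using has_field_derivative_cong_eventually[of f1 ?f x S D1] f1 1 by simp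
    then show ?thesis using 1 by simp
  next
    case 2
    have "eventually (\<lambda>s. f2 s = ?f s) (at x within S)"
      using order_tendstoD(2)[OF lim 2] by eventually_elim simp
    then have "(?f has_field_derivative D2) (at x within S)"
      using has_field_derivative_cong_eventually[of f2 ?f x S D2] f2 2 by simp
    then show ?thesis using 2 by simp
  next
    case 3
    have "((\<lambda>s. if 0 \<le> e s then (f1 s - f1 x) / (s - x) else (f2 s - f2 x) / (s - x))
        \<longlongrightarrow> D1) (at x within S)"
      using f1 f2 eq[OF 3] unfolding has_field_derivative_iff
      by (intro filterlim_If tendsto_mono[OF inf_le1]) auto
    \<comment> \<open>Since \<open>f1 x = f2 x\<close>, both branches subtract the same base value
      \<open>?f x\<close>.\<close>
    moreover have "(\<lambda>s. if 0 \<le> e s then (f1 s - f1 x) / (s - x) else (f2 s - f2 x) / (s - x))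
        = (\<lambda>s. (?f s - ?f x) / (s - x))"
      using eq[OF 3] 3 by auto
    ultimately show ?thesis using 3 unfolding has_field_derivative_iff by simp
  qed
qed

lemma continuous_on_glue:
  fixes e :: "'a::topological_space \<Rightarrow> real" and f g :: "'a \<Rightarrow> 'b::topological_space"
  assumes "continuous_on S f" "continuous_on S g" "continuous_on S e"
    and "\<And>x. x \<in> S \<Longrightarrow> e x = 0 \<Longrightarrow> f x = g x"
  shows "continuous_on S (\<lambda>x. if 0 \<le> e x then f x else g x)"
  using continuous_on_cases_le[of S "\<lambda>x. - e x" 0 f g] assms
  by (auto intro: continuous_on_subset continuous_on_minus)

section \<open>The positive root of \<open>u + \<kappa> * u^2 = q\<close>\<close>

definition quad_root :: "real \<Rightarrow> real \<Rightarrow> real" where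
  "quad_root \<kappa> q = (sqrt (1 + 4 * \<kappa> * q) - 1) / (2 * \<kappa>)"

lemma quad_root_pos: "\<kappa> > 0 \<Longrightarrow> q > 0 \<Longrightarrow> quad_root \<kappa> q > 0"
  by (simp add: quad_root_def)

lemma quad_root_eq:
  assumes "\<kappa> > 0" "q > 0"
  shows "quad_root \<kappa> q + \<kappa> * (quad_root \<kappa> q)\<^sup>2 = q"
proof -
  define s where "s = sqrt (1 + 4 * \<kappa> * q)"
  have s: "s\<^sup>2 = 1 + 4 * \<kappa> * q" using assms by (simp add: s_def)
  have "quad_root \<kappa> q + \<kappa> * (quad_root \<kappa> q)\<^sup>2 = (s\<^sup>2 - 1) / (4 * \<kappa>)"
    using assms unfolding quad_root_def s_def[symmetric]
    by (simp add: field_simps power2_eq_square)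
  then show ?thesis using assms s by simp
qed

text \<open>The difference of the two sides factors as
  \<open>(v - u) * (1 + \<kappa> * (u + v))\<close> with a positive second factor. This monotonicity
  gives uniqueness of the root and later lets \<open>u\<close> be compared with \<open>w\<close>
  without solving for \<open>u\<close>.\<close>

lemma quad_le_iff:
  fixes \<kappa> u v :: real
  assumes "\<kappa> > 0" "u \<ge> 0" "v \<ge> 0"
  shows "u + \<kappa> * u\<^sup>2 \<le> v + \<kappa> * v\<^sup>2 \<longleftrightarrow> u \<le> v"
proof -
  have "v + \<kappa> * v\<^sup>2 - (u + \<kappa> * u\<^sup>2) = (v - u) * (1 + \<kappa> * (u + v))"
    by (simp add: power2_eq_square algebra_simps)
  moreover have "1 + \<kappa> * (u + v) > 0" using assms by (simp add: add_pos_nonneg)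
  ultimately have "0 \<le> v + \<kappa> * v\<^sup>2 - (u + \<kappa> * u\<^sup>2) \<longleftrightarrow> 0 \<le> v - u"
    by (simp add: zero_le_mult_iff)
  then show ?thesis by simp
qed

lemma quad_root_unique:
  assumes "\<kappa> > 0" "q > 0" "u \<ge> 0" "u + \<kappa> * u\<^sup>2 = q"
  shows "u = quad_root \<kappa> q"
proof -
  have "quad_root \<kappa> q \<ge> 0" using quad_root_pos[OF assms(1,2)] by simp
  then show ?thesis
    using quad_root_eq[OF assms(1,2)] quad_le_iff[OF assms(1,3)] quad_le_iff[OF assms(1) _ assms(3)]
    by (metis antisym assms(4) order_refl)
qed

text \<open>The derivative is the one given by implicit differentiation of the quadratic equation;
  its denominator is exactly the square root in \<open>quad_root\<close>.\<close>

lemma has_real_derivative_quad_root: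
  assumes "\<kappa> > 0" "q > 0"
  shows "(quad_root \<kappa> has_real_derivative 1 / (1 + 2 * \<kappa> * quad_root \<kappa> q)) (at q)"
proof -
  have *: "1 + 4 * \<kappa> * q > 0" using assms by (simp add: add_pos_pos)
  have "1 + 2 * \<kappa> * quad_root \<kappa> q = sqrt (1 + 4 * \<kappa> * q)"
    using assms by (simp add: quad_root_def)
  then show ?thesis
    unfolding quad_root_def using assms *
    by (auto intro!: derivative_eq_intros simp: field_simps)
qed

section \<open>The explicit solution in the coordinates \<open>w\<close> and
  \<open>u\<close>\<close>

locale free_boundary_problem =
  fixes T \<sigma> \<sigma>0 \<mu>0 \<gamma> c \<beta> :: real
  assumes pos: "T > 0" "\<sigma> > 0" "\<sigma>0 > 0" "\<gamma> > 0" "c > 0" "\<beta> > 0"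
begin

definition a where "a = 1 / \<sigma>\<^sup>2"
text \<open>Normalised so that on the curve z = \<delta>(t) one has
  \<open>\<kappa> * w^2 = \<beta>^2 * (T - t)\<close>.\<close>

definition \<kappa> where "\<kappa> = 2 * \<beta>\<^sup>2 * c * \<gamma> / a"
definition w where "w t z = z + a * (T - t) + 1 / \<sigma>0\<^sup>2"
definition u where "u t z = quad_root \<kappa> (w t z + \<beta>\<^sup>2 * (T - t))"

text \<open>\<open>G_up\<close>, \<open>G_lo\<close> and \<open>G\<close> carry the part of P that
  is free of \<open>\<mu>0\<close>. The rest, a constant plus a multiple of \<open>H_fun\<close>, is
  the same in both branches.\<close>

definition G_up where
  "G_up t z = - ln (\<sigma>0\<^sup>2 * w t z) / 2 + a * (T - t) / (2 * w t z)"
text \<open>Obtained from the lower branch of \<open>P\<close> by \<open>\<beta>\<^sup>2 (t1 - t) = u - w\<close>.\<close>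

definition G_lo where
  "G_lo t z = - ln (\<sigma>0\<^sup>2 * u t z) / 2 + c * \<gamma> * (2 * u t z - w t z)
     + (a + \<beta>\<^sup>2) / (2 * \<beta>\<^sup>2) * (ln (u t z) - ln (w t z))"
definition G where "G t z = (if 0 \<le> w t z - u t z then G_up t z else G_lo t z)"
text \<open>\<open>Gt\<close> and \<open>Gz\<close> are the intended derivatives of \<open>G\<close>
  in t and z, split by the same sign test as \<open>G\<close> so that the gluing lemma yields them
  directly.\<close>

definition Gt where
  "Gt t z = (if 0 \<le> w t z - u t z then a\<^sup>2 * (T - t) / (2 * (w t z)\<^sup>2)
     else a * c * \<gamma> + a * (a + \<beta>\<^sup>2) / (2 * \<beta>\<^sup>2) * (1 / w t z - 1 / u t z))"
definition Gz where
  "Gz t z = (if 0 \<le> w t z - u t z then - 1 / (2 * w t z) - a * (T - t) / (2 * (w t z)\<^sup>2)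
     else a / (2 * \<beta>\<^sup>2 * u t z) - c * \<gamma> - (a + \<beta>\<^sup>2) / (2 * \<beta>\<^sup>2 * w t z))"

lemma a_pos: "a > 0" and \<kappa>_pos: "\<kappa> > 0"
  using pos by (simp_all add: a_def \<kappa>_def)

lemma a_\<kappa>: "a * \<kappa> = 2 * \<beta>\<^sup>2 * c * \<gamma>"
  using a_pos by (simp add: \<kappa>_def)

lemma w_pos: "t \<le> T \<Longrightarrow> z \<ge> 0 \<Longrightarrow> w t z > 0"
  unfolding w_def using a_pos pos by (simp add: add_nonneg_pos)

section \<open>Position relative to the boundary, and the derivatives of \<open>G\<close>\<close>

context
  fixes t z :: real
  assumes t: "t \<le> T" and z: "z \<ge> 0"
begin

lemma q_pos: "w t z + \<beta>\<^sup>2 * (T - t) > 0"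
  using w_pos[OF t z] t by (simp add: add_pos_nonneg)

lemma u_pos: "u t z > 0"
  unfolding u_def by (rule quad_root_pos[OF \<kappa>_pos q_pos])

lemma u_eq: "u t z + \<kappa> * (u t z)\<^sup>2 = w t z + \<beta>\<^sup>2 * (T - t)"
  unfolding u_def by (rule quad_root_eq[OF \<kappa>_pos q_pos])

text \<open>Since \<open>u + \<kappa> * u^2\<close> equals \<open>w + \<beta>^2 * (T - t)\<close>,
  comparing it with \<open>w + \<kappa> * w^2\<close> cancels \<open>w\<close> and leaves the
  parabola.\<close>

lemma u_le_w_iff: "u t z \<le> w t z \<longleftrightarrow> \<beta>\<^sup>2 * (T - t) \<le> \<kappa> * (w t z)\<^sup>2"
  using quad_le_iff[OF \<kappa>_pos, of "u t z" "w t z"] u_eq u_pos w_pos[OF t z] by simp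

lemma w_le_u_iff: "w t z \<le> u t z \<longleftrightarrow> \<kappa> * (w t z)\<^sup>2 \<le> \<beta>\<^sup>2 * (T - t)"
  using quad_le_iff[OF \<kappa>_pos, of "w t z" "u t z"] u_eq u_pos w_pos[OF t z] by simp

lemma boundary_eq:
  assumes "u t z = w t z"
  shows "a * (T - t) = 2 * c * \<gamma> * (w t z)\<^sup>2"
proof -
  have "\<beta>\<^sup>2 * (T - t) = \<kappa> * (w t z)\<^sup>2" using u_eq assms by simp
  then have "\<beta>\<^sup>2 * (a * (T - t)) = (a * \<kappa>) * (w t z)\<^sup>2"
    by (metis mult.assoc mult.left_commute)
  then have "\<beta>\<^sup>2 * (a * (T - t)) = \<beta>\<^sup>2 * (2 * c * \<gamma> * (w t z)\<^sup>2)"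
    unfolding a_\<kappa> by (simp only: mult_ac)
  then show ?thesis using pos by (metis mult_left_cancel zero_neq_numeral less_irrefl power_not_zero)
qed

text \<open>Differentiating along a curve \<open>(f x, g x)\<close> covers the t- and the
  z-derivative in one computation. The chain rule through \<open>u\<close> collapses: the
  \<open>u\<close>-derivative of \<open>G_lo\<close> is \<open>a / (2 * \<beta>^2 * u)\<close> times
  \<open>1 + 2 * \<kappa> * u\<close>, and the second factor cancels against du/dq.\<close>

lemma G_lo_deriv:
  assumes w': "((\<lambda>x. w (f x) (g x)) has_real_derivative w') (at x within S)"
    and q': "((\<lambda>x. w (f x) (g x) + \<beta>\<^sup>2 * (T - f x)) has_real_derivative q') (at x within S)"
    and fg: "f x = t" "g x = z"
  shows "((\<lambda>x. G_lo (f x) (g x)) has_real_derivative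
    a / (2 * \<beta>\<^sup>2 * u t z) * q' - (c * \<gamma> + (a + \<beta>\<^sup>2) / (2 * \<beta>\<^sup>2 * w t z)) * w') (at x within S)"
proof -
  define D where "D = 1 + 2 * \<kappa> * u t z"
  have D: "D > 0" using \<kappa>_pos u_pos by (simp add: D_def add_pos_pos)
  have u': "((\<lambda>x. u (f x) (g x)) has_real_derivative 1 / D * q') (at x within S)"
    unfolding u_def D_def
    using DERIV_chain2[of "quad_root \<kappa>" "1 / (1 + 2 * \<kappa> * u t z)"
        "\<lambda>x. w (f x) (g x) + \<beta>\<^sup>2 * (T - f x)", OF _ q']
      has_real_derivative_quad_root[OF \<kappa>_pos q_pos]
    by (simp add: fg u_def)
  \<comment> \<open>\<open>D\<close> is the denominator of \<open>du/dq\<close>; it cancels because \<open>a \<kappa> = 2 \<beta>\<^sup>2 c \<gamma>\<close>.\<close>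
  have AD: "a / (2 * \<beta>\<^sup>2 * u t z) * D = a / (2 * \<beta>\<^sup>2 * u t z) + 2 * c * \<gamma>"
    using u_pos pos a_\<kappa> by (simp add: D_def field_simps)
  \<comment> \<open>The right-hand side lists the \<open>u\<close>-derivatives of the first
    logarithm, the linear term and the second logarithm of \<open>G_lo\<close>.\<close>
  have E: "a / (2 * \<beta>\<^sup>2 * u t z) + 2 * c * \<gamma>
      = - 1 / (2 * u t z) + 2 * c * \<gamma> + (a + \<beta>\<^sup>2) / (2 * \<beta>\<^sup>2) / u t z"
    using u_pos pos by (simp add: field_simps)
  have "a / (2 * \<beta>\<^sup>2 * u t z) * q' = (a / (2 * \<beta>\<^sup>2 * u t z) * D) * (1 / D * q')"
    using D by simp
  also have "\<dots> = (- 1 / (2 * u t z) + 2 * c * \<gamma> + (a + \<beta>\<^sup>2) / (2 * \<beta>\<^sup>2) / u t z) * (1 / D * q')"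
    unfolding AD E ..
  finally have A: "a / (2 * \<beta>\<^sup>2 * u t z) * q' = \<dots>" .
  have ln': "((\<lambda>x. ln (\<sigma>0\<^sup>2 * u (f x) (g x))) has_real_derivative 1 / D * q' / u t z) (at x within S)"
    using u_pos pos fg by (auto intro!: derivative_eq_intros u' simp: field_simps)
  have lnu': "((\<lambda>x. ln (u (f x) (g x))) has_real_derivative 1 / D * q' / u t z) (at x within S)"
    using u_pos pos fg by (auto intro!: derivative_eq_intros u' simp: field_simps)
  have lnw': "((\<lambda>x. ln (w (f x) (g x))) has_real_derivative w' / w t z) (at x within S)"
    using w_pos[OF t z] pos fg by (auto intro!: derivative_eq_intros w' simp: field_simps)
  have "((\<lambda>x. G_lo (f x) (g x)) has_real_derivative
      - (1 / D * q' / u t z) / 2 + c * \<gamma> * (2 * (1 / D * q') - w')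
      + (a + \<beta>\<^sup>2) / (2 * \<beta>\<^sup>2) * (1 / D * q' / u t z - w' / w t z)) (at x within S)"
    unfolding G_lo_def
    by (intro DERIV_add DERIV_diff DERIV_cmult DERIV_cdivide DERIV_minus ln' lnu' lnw' u' w')
  then show ?thesis
    unfolding A
    by (rule DERIV_cong) (simp add: ring_distribs add_divide_distrib diff_divide_distrib mult_ac)
qed

lemma G_up_deriv:
  assumes w': "((\<lambda>x. w (f x) (g x)) has_real_derivative w') (at x within S)"
    and f': "(f has_real_derivative f') (at x within S)"
    and fg: "f x = t" "g x = z"
  shows "((\<lambda>x. G_up (f x) (g x)) has_real_derivative
    - w' / (2 * w t z) - a * f' / (2 * w t z) - a * (T - t) * w' / (2 * (w t z)\<^sup>2)) (at x within S)"
proof -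
  have lnw': "((\<lambda>x. ln (\<sigma>0\<^sup>2 * w (f x) (g x))) has_real_derivative w' / w t z) (at x within S)"
    using w_pos[OF t z] pos fg by (auto intro!: derivative_eq_intros w' simp: field_simps)
  have "((\<lambda>x. a * (T - f x) / (2 * w (f x) (g x))) has_real_derivative
     - a * f' / (2 * w t z) - a * (T - t) * w' / (2 * (w t z)\<^sup>2)) (at x within S)"
    using w_pos[OF t z]
    by (auto intro!: derivative_eq_intros w' f' simp: fg field_simps power2_eq_square)
  from DERIV_add[OF DERIV_cdivide[OF DERIV_minus[OF lnw'], of 2] this] show ?thesis
    unfolding G_up_def by (rule DERIV_cong) simp
qed

text \<open>For \<open>u = w\<close> the logarithms of \<open>u\<close> and \<open>w\<close> cancel
  in \<open>G_lo\<close>, and \<open>boundary_eq\<close> turns \<open>a * (T - t) / (2 * w)\<close>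
  into \<open>c * \<gamma> * w\<close>.\<close>

lemma G_match:
  assumes "u t z = w t z"
  shows "G_up t z = G_lo t z"
  using boundary_eq[OF assms] w_pos[OF t z]
  by (simp add: G_up_def G_lo_def assms power2_eq_square)

text \<open>On the boundary both sides equal \<open>a * c * \<gamma>\<close>.\<close>

lemma Gt_match:
  assumes "u t z = w t z"
  shows "a\<^sup>2 * (T - t) / (2 * (w t z)\<^sup>2)
    = a * c * \<gamma> + a * (a + \<beta>\<^sup>2) / (2 * \<beta>\<^sup>2) * (1 / w t z - 1 / u t z)"
proof -
  have "a * (T - t) / (2 * (w t z)\<^sup>2) = c * \<gamma>"
    using boundary_eq[OF assms] w_pos[OF t z] by simp
  then have "a * (a * (T - t) / (2 * (w t z)\<^sup>2)) = a * (c * \<gamma>)" by simp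
  then show ?thesis by (simp add: assms power2_eq_square mult.assoc)
qed

text \<open>On the boundary both sides equal \<open>- 1 / (2 * w) - c * \<gamma>\<close>.\<close>

lemma Gz_match:
  assumes "u t z = w t z"
  shows "- 1 / (2 * w t z) - a * (T - t) / (2 * (w t z)\<^sup>2)
    = a / (2 * \<beta>\<^sup>2 * u t z) - c * \<gamma> - (a + \<beta>\<^sup>2) / (2 * \<beta>\<^sup>2 * w t z)"
proof -
  have "a * (T - t) / (2 * (w t z)\<^sup>2) = c * \<gamma>"
    using boundary_eq[OF assms] w_pos[OF t z] by simp
  moreover have "(a + \<beta>\<^sup>2) / (2 * \<beta>\<^sup>2 * w t z) = a / (2 * \<beta>\<^sup>2 * u t z) + 1 / (2 * w t z)"
    using w_pos[OF t z] pos by (simp add: assms field_simps)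
  ultimately show ?thesis by simp
qed

lemma wu_continuous:
  "continuous (at t within S) (\<lambda>s. w s z - u s z)"
  "continuous (at z within R) (\<lambda>s. w t s - u t s)"
  unfolding u_def quad_root_def w_def using \<kappa>_pos by (auto intro!: continuous_intros)

text \<open>Along the t-direction \<open>w\<close> has slope \<open>- a\<close> and
  \<open>w + \<beta>^2 * (T - t)\<close> has slope \<open>- (a + \<beta>^2)\<close>; the matching
  lemmas then allow the two pieces to be glued. An arbitrary set \<open>S\<close> covers the
  one-sided derivatives at the ends of the time interval.\<close>

lemma G_has_t_derivative: "((\<lambda>s. G s z) has_real_derivative Gt t z) (at t within S)"
proof -
  have w': "((\<lambda>s. w s z) has_real_derivative - a) (at t within S)"
    unfolding w_def by (auto intro!: derivative_eq_intros)
  have q': "((\<lambda>s. w s z + \<beta>\<^sup>2 * (T - s)) has_real_derivative - (a + \<beta>\<^sup>2)) (at t within S)"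
    by (auto intro!: derivative_eq_intros w')
  have lo: "((\<lambda>s. G_lo s z) has_real_derivative
      a * c * \<gamma> + a * (a + \<beta>\<^sup>2) / (2 * \<beta>\<^sup>2) * (1 / w t z - 1 / u t z)) (at t within S)"
    using u_pos w_pos[OF t z] pos
    by (intro DERIV_cong[OF G_lo_deriv[OF w' q' refl refl]]) (simp add: field_simps)
  have up: "((\<lambda>s. G_up s z) has_real_derivative a\<^sup>2 * (T - t) / (2 * (w t z)\<^sup>2)) (at t within S)"
    using w_pos[OF t z]
    by (intro DERIV_cong[OF G_up_deriv[OF w' DERIV_ident refl refl]])
      (simp add: field_simps power2_eq_square)
  show ?thesis
    unfolding G_def Gt_def
    by (rule has_field_derivative_glue[OF up lo wu_continuous(1)]) (use G_match Gt_match in simp)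
qed

lemma G_has_z_derivative: "((\<lambda>s. G t s) has_real_derivative Gz t z) (at z within S)"
proof -
  have w': "((\<lambda>s. w t s) has_real_derivative 1) (at z within S)"
    unfolding w_def by (auto intro!: derivative_eq_intros)
  have q': "((\<lambda>s. w t s + \<beta>\<^sup>2 * (T - t)) has_real_derivative 1) (at z within S)"
    by (auto intro!: derivative_eq_intros w')
  have lo: "((\<lambda>s. G_lo t s) has_real_derivative
      a / (2 * \<beta>\<^sup>2 * u t z) - c * \<gamma> - (a + \<beta>\<^sup>2) / (2 * \<beta>\<^sup>2 * w t z)) (at z within S)"
    by (rule DERIV_cong[OF G_lo_deriv[OF w' q' refl refl]]) simp
  have up: "((\<lambda>s. G_up t s) has_real_derivative
      - 1 / (2 * w t z) - a * (T - t) / (2 * (w t z)\<^sup>2)) (at z within S)"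
    by (rule DERIV_cong[OF G_up_deriv[OF w' DERIV_const refl refl]]) simp
  show ?thesis
    unfolding G_def Gz_def
    by (rule has_field_derivative_glue[OF up lo wu_continuous(2)]) (use G_match Gz_match in simp)
qed

end

section \<open>The given data H, P, \<delta> and t1 in the new coordinates\<close>

lemma H_eq: "H_fun T \<sigma> \<sigma>0 t z = 1 / (\<sigma>0\<^sup>2 * w t z)"
proof -
  have "\<sigma>0\<^sup>2 * w t z = \<sigma>0\<^sup>2 * z + \<sigma>0\<^sup>2 / \<sigma>\<^sup>2 * (T - t) + 1"
    using pos by (simp add: w_def a_def distrib_left)
  then show ?thesis by (simp add: H_fun_def)
qed

lemma sqrt_eq: "sqrt ((T - s) / (2 * c * \<sigma>\<^sup>2 * \<gamma>)) = sqrt (\<beta>\<^sup>2 * (T - s) / \<kappa>)"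
  using pos by (simp add: \<kappa>_def a_def field_simps)

text \<open>The affine terms of \<open>delta\<close> are exactly those that \<open>w\<close> adds to
  z, so only the square root survives.\<close>

lemma w_delta: "w s (delta T \<sigma> \<sigma>0 \<gamma> c s) = sqrt (\<beta>\<^sup>2 * (T - s) / \<kappa>)"
  unfolding delta_def sqrt_eq by (simp add: w_def a_def diff_divide_distrib)

lemma w_mono: "w t z \<le> w t z' \<longleftrightarrow> z \<le> z'"
  by (simp add: w_def)

lemma continuous_on_delta: "continuous_on S (delta T \<sigma> \<sigma>0 \<gamma> c)"
  unfolding delta_def using pos by (intro continuous_intros) auto

text \<open>Writing \<open>z + a * (T - t)\<close> as \<open>w - 1 / \<sigma>0^2\<close> separates
  the bracket in \<open>P_upper\<close>: its \<open>w\<close>-term gives the constant, its constant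
  gives the multiple of H. The hypothesis is on \<open>w\<close> because the formula is also applied
  at the point where the characteristic meets the boundary.\<close>

lemma P_upper_eq:
  assumes "w t z > 0"
  shows "P_upper T \<sigma> \<sigma>0 \<mu>0 t z
    = - \<mu>0\<^sup>2 / (2 * \<sigma>0\<^sup>2) + \<mu>0\<^sup>2 / (2 * \<sigma>0\<^sup>2) * H_fun T \<sigma> \<sigma>0 t z + G_up t z"
proof -
  have N: "\<mu>0\<^sup>2 * z + (\<mu>0\<^sup>2 - \<sigma>0\<^sup>2) / \<sigma>\<^sup>2 * (T - t)
      = \<mu>0\<^sup>2 * w t z - \<mu>0\<^sup>2 / \<sigma>0\<^sup>2 - \<sigma>0\<^sup>2 * (a * (T - t))"
    by (simp add: w_def a_def algebra_simps diff_divide_distrib)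
  have L: "ln (1 / (\<sigma>0\<^sup>2 * w t z)) = - ln (\<sigma>0\<^sup>2 * w t z)"
    using assms pos by (simp add: ln_div)
  have "1 / (\<sigma>0\<^sup>2 * w t z) / 2 * (\<mu>0\<^sup>2 * w t z - \<mu>0\<^sup>2 / \<sigma>0\<^sup>2 - \<sigma>0\<^sup>2 * (a * (T - t)))
      = \<mu>0\<^sup>2 / (2 * \<sigma>0\<^sup>2) - \<mu>0\<^sup>2 / (2 * \<sigma>0\<^sup>2) * (1 / (\<sigma>0\<^sup>2 * w t z)) - a * (T - t) / (2 * w t z)"
    using assms pos by (simp add: right_diff_distrib diff_divide_distrib mult_ac)
  then show ?thesis
    unfolding P_upper_def G_up_def H_eq N L by simp
qed

context
  fixes t z :: real
  assumes t: "0 \<le> t" "t \<le> T" and z: "z \<ge> 0"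
begin

text \<open>As \<open>w\<close> increases with z, the comparison can be made between values of
  \<open>w\<close>; squaring it gives the parabola criterion for \<open>u\<close>.\<close>

lemma delta_le_iff: "delta T \<sigma> \<sigma>0 \<gamma> c t \<le> z \<longleftrightarrow> u t z \<le> w t z"
proof -
  have "delta T \<sigma> \<sigma>0 \<gamma> c t \<le> z \<longleftrightarrow> sqrt (\<beta>\<^sup>2 * (T - t) / \<kappa>) \<le> sqrt ((w t z)\<^sup>2)"
    using w_mono[of t _ z] w_pos[OF t(2) z] by (simp flip: w_delta)
  also have "\<dots> \<longleftrightarrow> u t z \<le> w t z"
    unfolding u_le_w_iff[OF t(2) z] real_sqrt_le_iff using \<kappa>_pos by (simp add: field_simps)
  finally show ?thesis .
qed

lemma le_delta_iff: "z \<le> delta T \<sigma> \<sigma>0 \<gamma> c t \<longleftrightarrow> w t z \<le> u t z"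
proof -
  have "z \<le> delta T \<sigma> \<sigma>0 \<gamma> c t \<longleftrightarrow> sqrt ((w t z)\<^sup>2) \<le> sqrt (\<beta>\<^sup>2 * (T - t) / \<kappa>)"
    using w_mono[of t z] w_pos[OF t(2) z] by (simp flip: w_delta)
  also have "\<dots> \<longleftrightarrow> w t z \<le> u t z"
    unfolding w_le_u_iff[OF t(2) z] real_sqrt_le_iff using \<kappa>_pos by (simp add: field_simps)
  finally show ?thesis .
qed

text \<open>In terms of \<open>v\<close>, the value of \<open>w\<close> at the boundary point of
  time s, the equation for s is the quadratic equation with unique non-negative root
  \<open>u\<close>. Solving \<open>v = u\<close> for s gives the explicit time.\<close>

lemma is_t1_iff:
  "is_t1 T \<sigma> \<sigma>0 \<gamma> c \<beta> t z s \<longleftrightarrow> 0 \<le> s \<and> s = T - \<kappa> * (u t z)\<^sup>2 / \<beta>\<^sup>2"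
proof (cases "s \<le> T")
  case True
  define v where "v = sqrt (\<beta>\<^sup>2 * (T - s) / \<kappa>)"
  have v: "v \<ge> 0" "\<kappa> * v\<^sup>2 = \<beta>\<^sup>2 * (T - s)"
    using True \<kappa>_pos by (simp_all add: v_def)
  \<comment> \<open>Adding \<open>(a + \<beta>^2) * (T - s) + 1 / \<sigma>0^2\<close> to both sides
    turns the left one into \<open>w + \<beta>^2 * (T - t)\<close>.\<close>
  have "(1 / \<sigma>\<^sup>2 + \<beta>\<^sup>2) * (s - t) + z = - (T - s) / \<sigma>\<^sup>2 - 1 / \<sigma>0\<^sup>2 + v
      \<longleftrightarrow> v + \<kappa> * v\<^sup>2 = w t z + \<beta>\<^sup>2 * (T - t)"
    unfolding v(2) by (auto simp: w_def a_def algebra_simps add_divide_distrib diff_divide_distrib)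
  also have "\<dots> \<longleftrightarrow> v = u t z"
    using quad_root_unique[OF \<kappa>_pos q_pos[OF t(2) z] v(1)] u_eq[OF t(2) z]
    by (auto simp: u_def)
  also have "\<dots> \<longleftrightarrow> \<kappa> * v\<^sup>2 = \<kappa> * (u t z)\<^sup>2"
    using v(1) u_pos[OF t(2) z] \<kappa>_pos by (simp add: power2_eq_iff_nonneg)
  also have "\<dots> \<longleftrightarrow> s = T - \<kappa> * (u t z)\<^sup>2 / \<beta>\<^sup>2"
    unfolding v(2) using pos by (auto simp: field_simps)
  finally show ?thesis
    unfolding is_t1_def sqrt_eq v_def[symmetric] using True by auto
next
  case False
  moreover have "T - \<kappa> * (u t z)\<^sup>2 / \<beta>\<^sup>2 \<le> T" using \<kappa>_pos by simp
  ultimately show ?thesis unfolding is_t1_def by auto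
qed

text \<open>Below the boundary \<open>w < u\<close>, and \<open>u - w\<close> is
  \<open>\<beta>^2 * (t1 - t)\<close>; hence t1 exceeds t and is non-negative as required in
  \<open>is_t1\<close>. The characteristic moves upward in z, so it meets the boundary at a height
  at least z.\<close>

lemma below_boundary:
  assumes "z < delta T \<sigma> \<sigma>0 \<gamma> c t" and t1_def: "t1 = T - \<kappa> * (u t z)\<^sup>2 / \<beta>\<^sup>2"
  shows "t < t1" "is_t1 T \<sigma> \<sigma>0 \<gamma> c \<beta> t z s \<longleftrightarrow> s = t1" "t1_fun T \<sigma> \<sigma>0 \<gamma> c \<beta> t z = t1"
    and "w t1 (delta T \<sigma> \<sigma>0 \<gamma> c t1) = u t z" "delta T \<sigma> \<sigma>0 \<gamma> c t1 \<ge> 0"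
    and "\<beta>\<^sup>2 * (t1 - t) = u t z - w t z"
proof -
  have "w t z < u t z" using delta_le_iff assms(1) by simp
  moreover show eq: "\<beta>\<^sup>2 * (t1 - t) = u t z - w t z"
  proof -
    have "\<beta>\<^sup>2 * (t1 - t) = \<beta>\<^sup>2 * (T - t) - \<kappa> * (u t z)\<^sup>2"
      using pos by (simp add: t1_def right_diff_distrib)
    then show ?thesis using u_eq[OF t(2) z] by simp
  qed
  ultimately have "\<beta>\<^sup>2 * (t1 - t) > 0" by simp
  then show lt: "t < t1" by (simp add: zero_less_mult_iff)
  have iff: "is_t1 T \<sigma> \<sigma>0 \<gamma> c \<beta> t z r \<longleftrightarrow> r = t1" for r
    unfolding is_t1_iff t1_def[symmetric] using lt t(1) by auto
  then show "is_t1 T \<sigma> \<sigma>0 \<gamma> c \<beta> t z s \<longleftrightarrow> s = t1" .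
  from iff show "t1_fun T \<sigma> \<sigma>0 \<gamma> c \<beta> t z = t1" by (simp add: t1_fun_def)
  show w1: "w t1 (delta T \<sigma> \<sigma>0 \<gamma> c t1) = u t z"
    using u_pos[OF t(2) z] \<kappa>_pos pos by (simp add: w_delta t1_def)
  have "(1 / \<sigma>\<^sup>2 + \<beta>\<^sup>2) * (t1 - t) + z = delta T \<sigma> \<sigma>0 \<gamma> c t1"
    using iff[of t1] by (simp add: is_t1_def delta_def)
  moreover have "(1 / \<sigma>\<^sup>2 + \<beta>\<^sup>2) * (t1 - t) \<ge> 0" using lt by simp
  ultimately show "delta T \<sigma> \<sigma>0 \<gamma> c t1 \<ge> 0" using z by linarith
qed

lemma P_fun_eq:
  "P_fun T \<sigma> \<sigma>0 \<mu>0 \<gamma> c \<beta> t z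
    = - \<mu>0\<^sup>2 / (2 * \<sigma>0\<^sup>2) + \<mu>0\<^sup>2 / (2 * \<sigma>0\<^sup>2) * H_fun T \<sigma> \<sigma>0 t z + G t z"
proof (cases "delta T \<sigma> \<sigma>0 \<gamma> c t \<le> z")
  case True
  then show ?thesis
    using delta_le_iff P_upper_eq[OF w_pos[OF t(2) z]] z by (simp add: P_fun_def G_def)
next
  case False
  then have lt: "z < delta T \<sigma> \<sigma>0 \<gamma> c t" by simp
  define t1 where "t1 = T - \<kappa> * (u t z)\<^sup>2 / \<beta>\<^sup>2"
  define d1 where "d1 = delta T \<sigma> \<sigma>0 \<gamma> c t1"
  note b = below_boundary[OF lt t1_def, folded d1_def]
  have up: "u t z > 0" by (rule u_pos[OF t(2) z])
  have "a * (T - t1) = 2 * c * \<gamma> * (u t z)\<^sup>2"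
  proof -
    have "a * (T - t1) = a * \<kappa> * (u t z)\<^sup>2 / \<beta>\<^sup>2" by (simp add: t1_def)
    then show ?thesis unfolding a_\<kappa> using pos by simp
  qed
  \<comment> \<open>The point \<open>(t1, d1)\<close> lies on the boundary, where
    \<open>a * (T - t1) / (2 * u)\<close> is \<open>c * \<gamma> * u\<close>.\<close>
  then have G1: "G_up t1 d1 = - ln (\<sigma>0\<^sup>2 * u t z) / 2 + c * \<gamma> * u t z"
    using up by (simp add: G_up_def b(4) power2_eq_square)
  have "\<beta>\<^sup>2 * c * \<gamma> * (t1 - t) = c * \<gamma> * (\<beta>\<^sup>2 * (t1 - t))" by simp
  then have B: "\<beta>\<^sup>2 * c * \<gamma> * (t1 - t) = c * \<gamma> * (u t z - w t z)" by (simp only: b(6))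
  have L: "ln (H_fun T \<sigma> \<sigma>0 t1 d1) - ln (H_fun T \<sigma> \<sigma>0 t z) = ln (w t z) - ln (u t z)"
    unfolding H_eq b(4) using up w_pos[OF t(2) z] pos by (simp add: ln_div ln_mult)
  have "P_fun T \<sigma> \<sigma>0 \<mu>0 \<gamma> c \<beta> t z = P_upper T \<sigma> \<sigma>0 \<mu>0 t1 d1 + \<beta>\<^sup>2 * c * \<gamma> * (t1 - t)
              - \<mu>0\<^sup>2 / (2 * \<sigma>0\<^sup>2) * (H_fun T \<sigma> \<sigma>0 t1 d1 - H_fun T \<sigma> \<sigma>0 t z)
              - (\<beta>\<^sup>2 + 1 / \<sigma>\<^sup>2) / (2 * \<beta>\<^sup>2)
                * (ln (H_fun T \<sigma> \<sigma>0 t1 d1) - ln (H_fun T \<sigma> \<sigma>0 t z))"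
    using lt by (simp add: P_fun_def b(3) Let_def d1_def)
  also have "\<dots> = - \<mu>0\<^sup>2 / (2 * \<sigma>0\<^sup>2) + \<mu>0\<^sup>2 / (2 * \<sigma>0\<^sup>2) * H_fun T \<sigma> \<sigma>0 t z + G_lo t z"
  proof -
    \<comment> \<open>With the quotients named, the identity is purely algebraic: the multiples of H
      at \<open>(t1, d1)\<close> cancel, and the terms linear in \<open>u\<close> and
      \<open>w\<close> add up to \<open>c * \<gamma> * (2 * u - w)\<close>.\<close>
    define k1 where "k1 = \<mu>0\<^sup>2 / (2 * \<sigma>0\<^sup>2)"
    define k2 where "k2 = (a + \<beta>\<^sup>2) / (2 * \<beta>\<^sup>2)"
    have k2: "(\<beta>\<^sup>2 + 1 / \<sigma>\<^sup>2) / (2 * \<beta>\<^sup>2) = k2" by (simp add: k2_def a_def add.commute)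
    have P1: "P_upper T \<sigma> \<sigma>0 \<mu>0 t1 d1
        = - \<mu>0\<^sup>2 / (2 * \<sigma>0\<^sup>2) + k1 * H_fun T \<sigma> \<sigma>0 t1 d1 + G_up t1 d1"
      unfolding k1_def by (rule P_upper_eq) (simp add: b(4) up)
    show ?thesis
      unfolding L B P1 G1 G_lo_def k2 k1_def[symmetric] k2_def[symmetric]
      by (simp add: algebra_simps)
  qed
  finally show ?thesis using lt delta_le_iff by (simp add: G_def)
qed

text \<open>This recovers the recursive form of the lower branch: the boundary point has
  non-negative height, so \<open>P_fun\<close> there is given by \<open>P_upper\<close>.\<close>

lemma P_fun_below_boundary:
  assumes "z < delta T \<sigma> \<sigma>0 \<gamma> c t"
  shows "let t1 = t1_fun T \<sigma> \<sigma>0 \<gamma> c \<beta> t z; d1 = delta T \<sigma> \<sigma>0 \<gamma> c t1 in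
            P_fun T \<sigma> \<sigma>0 \<mu>0 \<gamma> c \<beta> t z =
              P_fun T \<sigma> \<sigma>0 \<mu>0 \<gamma> c \<beta> t1 d1 + \<beta>\<^sup>2 * c * \<gamma> * (t1 - t)
              - \<mu>0\<^sup>2 / (2 * \<sigma>0\<^sup>2) * (H_fun T \<sigma> \<sigma>0 t1 d1 - H_fun T \<sigma> \<sigma>0 t z)
              - (\<beta>\<^sup>2 + 1 / \<sigma>\<^sup>2) / (2 * \<beta>\<^sup>2)
                * (ln (H_fun T \<sigma> \<sigma>0 t1 d1) - ln (H_fun T \<sigma> \<sigma>0 t z))"
proof -
  define t1 where "t1 = t1_fun T \<sigma> \<sigma>0 \<gamma> c \<beta> t z"
  have "delta T \<sigma> \<sigma>0 \<gamma> c t1 \<ge> 0"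
    using below_boundary(3,5)[OF assms refl] by (simp add: t1_def)
  then have "P_fun T \<sigma> \<sigma>0 \<mu>0 \<gamma> c \<beta> t1 (delta T \<sigma> \<sigma>0 \<gamma> c t1)
      = P_upper T \<sigma> \<sigma>0 \<mu>0 t1 (delta T \<sigma> \<sigma>0 \<gamma> c t1)"
    by (simp add: P_fun_def)
  then show ?thesis
    using assms unfolding t1_def[symmetric] by (simp add: P_fun_def t1_def Let_def)
qed

text \<open>The multiple of H in \<open>P_fun_eq\<close> is exactly what completes the square in
  y.\<close>

lemma h_fun_eq:
  "h_fun T \<sigma> \<sigma>0 \<mu>0 \<gamma> c \<beta> t y z
    = - \<mu>0\<^sup>2 / (2 * \<sigma>0\<^sup>2) + (\<mu>0 + \<sigma>0\<^sup>2 * y)\<^sup>2 / (2 * \<sigma>0^4 * w t z) + G t z"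
  unfolding h_fun_def P_fun_eq H_eq using w_pos[OF t(2) z] pos
  by (simp add: field_simps power2_eq_square power4_eq_xxxx)

end

section \<open>Partial derivatives of h, the switching function and the two equations\<close>

context
  fixes t z :: real
  assumes t: "0 \<le> t" "t \<le> T" and z: "z \<ge> 0"
begin

text \<open>The explicit form of h is available for times in \<open>{0..T}\<close>, which suffices
  because the derivative is taken within that interval.\<close>

lemma h_fun_has_t_derivative:
  "((\<lambda>s. h_fun T \<sigma> \<sigma>0 \<mu>0 \<gamma> c \<beta> s y z) has_vector_derivative
     a * (\<mu>0 + \<sigma>0\<^sup>2 * y)\<^sup>2 / (2 * \<sigma>0^4 * (w t z)\<^sup>2) + Gt t z) (at t within {0..T})"
proof -
  define C where "C = (\<mu>0 + \<sigma>0\<^sup>2 * y)\<^sup>2 / (2 * \<sigma>0^4)"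
  have main: "((\<lambda>s. - \<mu>0\<^sup>2 / (2 * \<sigma>0\<^sup>2) + C / w s z + G s z) has_real_derivative
      C * a / (w t z)\<^sup>2 + Gt t z) (at t within {0..T})"
    using w_pos[OF t(2) z] unfolding w_def
    by (auto intro!: derivative_eq_intros G_has_t_derivative[OF t(2) z] simp: power2_eq_square)
  have eq:
    "h_fun T \<sigma> \<sigma>0 \<mu>0 \<gamma> c \<beta> s y z = - \<mu>0\<^sup>2 / (2 * \<sigma>0\<^sup>2) + C / w s z + G s z"
    if "s \<in> {0..T}" for s
    using h_fun_eq[of s z y] that t z by (simp add: C_def)
  have "((\<lambda>s. h_fun T \<sigma> \<sigma>0 \<mu>0 \<gamma> c \<beta> s y z) has_vector_derivative
      C * a / (w t z)\<^sup>2 + Gt t z) (at t within {0..T})"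
    by (rule has_vector_derivative_transform[OF _ eq
          main[unfolded has_real_derivative_iff_has_vector_derivative]]) (use t z in auto)
  then show ?thesis by (simp add: C_def mult.commute)
qed

lemma h_fun_has_z_derivative:
  "((\<lambda>s. h_fun T \<sigma> \<sigma>0 \<mu>0 \<gamma> c \<beta> t y s) has_vector_derivative
     - (\<mu>0 + \<sigma>0\<^sup>2 * y)\<^sup>2 / (2 * \<sigma>0^4 * (w t z)\<^sup>2) + Gz t z) (at z within {0..})"
proof -
  define C where "C = (\<mu>0 + \<sigma>0\<^sup>2 * y)\<^sup>2 / (2 * \<sigma>0^4)"
  have main: "((\<lambda>s. - \<mu>0\<^sup>2 / (2 * \<sigma>0\<^sup>2) + C / w t s + G t s) has_real_derivative
      - C / (w t z)\<^sup>2 + Gz t z) (at z within {0..})"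
    using w_pos[OF t(2) z] unfolding w_def
    by (auto intro!: derivative_eq_intros G_has_z_derivative[OF t(2) z] simp: power2_eq_square)
  have eq:
    "h_fun T \<sigma> \<sigma>0 \<mu>0 \<gamma> c \<beta> t y s = - \<mu>0\<^sup>2 / (2 * \<sigma>0\<^sup>2) + C / w t s + G t s"
    if "s \<in> {0..}" for s
    using h_fun_eq[of t s y] that t z by (simp add: C_def)
  have "((\<lambda>s. h_fun T \<sigma> \<sigma>0 \<mu>0 \<gamma> c \<beta> t y s) has_vector_derivative
      - C / (w t z)\<^sup>2 + Gz t z) (at z within {0..})"
    by (rule has_vector_derivative_transform[OF _ eq
          main[unfolded has_real_derivative_iff_has_vector_derivative]]) (use t z in auto)
  then show ?thesis by (simp add: C_def mult.commute)
qed

lemma h_fun_has_y_derivative: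
  "((\<lambda>s. h_fun T \<sigma> \<sigma>0 \<mu>0 \<gamma> c \<beta> t s z) has_vector_derivative
     (\<mu>0 + \<sigma>0\<^sup>2 * y) / (\<sigma>0\<^sup>2 * w t z)) (at y)"
  unfolding h_fun_eq[OF t z] has_real_derivative_iff_has_vector_derivative[symmetric]
  using w_pos[OF t(2) z] pos
  by (auto intro!: derivative_eq_intros simp: field_simps power2_eq_square power4_eq_xxxx)

text \<open>As \<open>T > 0\<close>, every time in \<open>{0..T}\<close> is a limit point of the
  interval, so the one-sided derivative is unique and \<open>vector_derivative\<close> returns
  it.\<close>

lemma pd_t_h_fun:
  "pd_t T (h_fun T \<sigma> \<sigma>0 \<mu>0 \<gamma> c \<beta>) t y z
    = a * (\<mu>0 + \<sigma>0\<^sup>2 * y)\<^sup>2 / (2 * \<sigma>0^4 * (w t z)\<^sup>2) + Gt t z"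
  unfolding pd_t_def using t pos(1)
  by (intro vector_derivative_within h_fun_has_t_derivative) (simp add: trivial_limit_within islimpt_Icc)

lemma pd_z_h_fun:
  "pd_z (h_fun T \<sigma> \<sigma>0 \<mu>0 \<gamma> c \<beta>) t y z
    = - (\<mu>0 + \<sigma>0\<^sup>2 * y)\<^sup>2 / (2 * \<sigma>0^4 * (w t z)\<^sup>2) + Gz t z"
proof -
  have "z islimpt {z..z + 1}" by (simp add: islimpt_Icc)
  then have "z islimpt {0..}" by (rule islimpt_subset) (use z in auto)
  then show ?thesis
    unfolding pd_z_def
    by (intro vector_derivative_within h_fun_has_z_derivative) (simp add: trivial_limit_within)
qed

lemma pd_y_h_fun:
  "pd_y (h_fun T \<sigma> \<sigma>0 \<mu>0 \<gamma> c \<beta>) t y z = (\<mu>0 + \<sigma>0\<^sup>2 * y) / (\<sigma>0\<^sup>2 * w t z)"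
  unfolding pd_y_def by (rule vector_derivative_at[OF h_fun_has_y_derivative])

lemma pd_y_h_fun_has_y_derivative:
  "((\<lambda>s. pd_y (h_fun T \<sigma> \<sigma>0 \<mu>0 \<gamma> c \<beta>) t s z) has_vector_derivative 1 / w t z) (at y)"
  unfolding pd_y_h_fun has_real_derivative_iff_has_vector_derivative[symmetric]
  using w_pos[OF t(2) z] pos by (auto intro!: derivative_eq_intros)

lemma pd_yy_h_fun: "pd_y (pd_y (h_fun T \<sigma> \<sigma>0 \<mu>0 \<gamma> c \<beta>)) t y z = 1 / w t z"
  unfolding pd_y_def[of "pd_y _"] by (rule vector_derivative_at[OF pd_y_h_fun_has_y_derivative])

text \<open>The square in y coming from the z-derivative cancels against half the squared
  y-derivative, so the switching function does not depend on y.\<close>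

lemma switch_fun_eq:
  "switch_fun \<gamma> c (h_fun T \<sigma> \<sigma>0 \<mu>0 \<gamma> c \<beta>) t y z = Gz t z + 1 / (2 * w t z) + c * \<gamma>"
proof -
  have "(\<mu>0 + \<sigma>0\<^sup>2 * y)\<^sup>2 / (2 * \<sigma>0^4 * (w t z)\<^sup>2) = 1/2 * ((\<mu>0 + \<sigma>0\<^sup>2 * y) / (\<sigma>0\<^sup>2 * w t z))\<^sup>2"
    by (simp add: power_divide power_mult_distrib flip: power_mult)
  then show ?thesis
    unfolding switch_fun_def pd_z_h_fun pd_y_h_fun pd_yy_h_fun by simp
qed

lemma switch_above:
  assumes "u t z \<le> w t z"
  shows "Gz t z + 1 / (2 * w t z) + c * \<gamma> = c * \<gamma> - a * (T - t) / (2 * (w t z)\<^sup>2)"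
  using assms by (simp add: Gz_def)

lemma switch_below:
  assumes "w t z < u t z"
  shows "Gz t z + 1 / (2 * w t z) + c * \<gamma> = a / (2 * \<beta>\<^sup>2) * (1 / u t z - 1 / w t z)"
  using assms w_pos[OF t(2) z] pos by (simp add: Gz_def field_simps)

lemma switch_pos_iff:
  "switch_fun \<gamma> c (h_fun T \<sigma> \<sigma>0 \<mu>0 \<gamma> c \<beta>) t y z > 0 \<longleftrightarrow> delta T \<sigma> \<sigma>0 \<gamma> c t < z"
proof -
  have wp: "w t z > 0" by (rule w_pos[OF t(2) z])
  have "Gz t z + 1 / (2 * w t z) + c * \<gamma> > 0 \<longleftrightarrow> u t z < w t z"
  proof (cases "u t z \<le> w t z")
    case True
    have "Gz t z + 1 / (2 * w t z) + c * \<gamma> > 0 \<longleftrightarrow> a * (T - t) < 2 * c * \<gamma> * (w t z)\<^sup>2"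
      unfolding switch_above[OF True] using wp by (simp add: field_simps)
    \<comment> \<open>The factor \<open>\<beta>^2\<close> produces the coefficient
      \<open>2 * \<beta>^2 * c * \<gamma> = a * \<kappa>\<close>; cancelling \<open>a\<close> then
      leaves the parabola criterion.\<close>
    also have "\<dots> \<longleftrightarrow> \<beta>\<^sup>2 * (a * (T - t)) < \<beta>\<^sup>2 * (2 * c * \<gamma> * (w t z)\<^sup>2)"
      by (rule mult_less_cancel_left_pos[symmetric]) (use pos in simp)
    also have "\<dots> \<longleftrightarrow> a * (\<beta>\<^sup>2 * (T - t)) < (2 * \<beta>\<^sup>2 * c * \<gamma>) * (w t z)\<^sup>2"
      by (simp only: mult_ac)
    also have "\<dots> \<longleftrightarrow> \<beta>\<^sup>2 * (T - t) < \<kappa> * (w t z)\<^sup>2"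
      unfolding a_\<kappa>[symmetric] mult.assoc[of a] by (rule mult_less_cancel_left_pos[OF a_pos])
    also have "\<dots> \<longleftrightarrow> u t z < w t z" using w_le_u_iff[OF t(2) z] by linarith
    finally show ?thesis .
  next
    case False
    then have "1 / u t z - 1 / w t z < 0" using wp by (simp add: frac_less2)
    then have "a / (2 * \<beta>\<^sup>2) * (1 / u t z - 1 / w t z) < 0"
      using a_pos pos by (intro mult_pos_neg) auto
    then show ?thesis using switch_below False by simp
  qed
  then show ?thesis unfolding switch_fun_eq using le_delta_iff[OF t z] by linarith
qed

text \<open>Let \<open>L\<close> be the left side of the first equation and \<open>S\<close> the
  switching function. The left side of the second equation is identically
  \<open>L + \<beta>^2 * S\<close>, so \<open>L = 0\<close> is shown for \<open>u \<le> w\<close>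
  and \<open>L + \<beta>^2 * S = 0\<close> for \<open>w \<le> u\<close>.\<close>

lemma h_fun_pde:
  defines "h \<equiv> h_fun T \<sigma> \<sigma>0 \<mu>0 \<gamma> c \<beta>"
  shows "switch_fun \<gamma> c h t y z > 0 \<Longrightarrow>
           pd_t T h t y z + 1 / \<sigma>\<^sup>2 * (pd_z h t y z + 1/2 * pd_y (pd_y h) t y z) = 0"
    and "switch_fun \<gamma> c h t y z \<le> 0 \<Longrightarrow>
           pd_t T h t y z + (1 / \<sigma>\<^sup>2 + \<beta>\<^sup>2) * (pd_z h t y z + 1/2 * pd_y (pd_y h) t y z)
             + \<beta>\<^sup>2 / 2 * (pd_y h t y z)\<^sup>2 + \<beta>\<^sup>2 * c * \<gamma> = 0"
proof -
  define S where "S = Gz t z + 1 / (2 * w t z) + c * \<gamma>"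
  define L where "L = pd_t T h t y z + 1 / \<sigma>\<^sup>2 * (pd_z h t y z + 1/2 * pd_y (pd_y h) t y z)"
  have wp: "w t z > 0" and up: "u t z > 0" using w_pos u_pos t z by auto
  have L: "L = Gt t z + a * (Gz t z + 1 / (2 * w t z))"
    unfolding L_def h_def pd_t_h_fun pd_z_h_fun pd_yy_h_fun
    by (simp add: a_def algebra_simps)
  have S: "switch_fun \<gamma> c h t y z = S" unfolding S_def h_def by (rule switch_fun_eq)
  have above: "L = 0" if "u t z \<le> w t z"
    unfolding L using that wp by (simp add: Gt_def Gz_def power2_eq_square)
  have below: "L + \<beta>\<^sup>2 * S = 0" if "w t z < u t z"
    unfolding L S_def switch_below[OF that] using that wp up pos
    by (simp add: Gt_def Gz_def field_simps power2_eq_square)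
  show "pd_t T h t y z + 1 / \<sigma>\<^sup>2 * (pd_z h t y z + 1/2 * pd_y (pd_y h) t y z) = 0"
    if "switch_fun \<gamma> c h t y z > 0"
    using that switch_pos_iff delta_le_iff[OF t z] above unfolding h_def L_def by simp
  assume le: "switch_fun \<gamma> c h t y z \<le> 0"
  have "L + \<beta>\<^sup>2 * S = 0"
  \<comment> \<open>Boundary points belong to the second regime, but \<open>Gt\<close> and
    \<open>Gz\<close> use their upper branch there. Since \<open>S\<close> vanishes, the two
    equations coincide.\<close>
  proof (cases "u t z = w t z")
    case True
    then have "S = 0"
      unfolding S_def using switch_above boundary_eq[OF t(2) z True] wp by simp
    then show ?thesis using above True by simp
  next
    case False
    have "z \<le> delta T \<sigma> \<sigma>0 \<gamma> c t"
      using le switch_pos_iff[of y] unfolding h_def by simp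
    then show ?thesis using False le_delta_iff[OF t z] below by simp
  qed
  then show "pd_t T h t y z + (1 / \<sigma>\<^sup>2 + \<beta>\<^sup>2) * (pd_z h t y z + 1/2 * pd_y (pd_y h) t y z)
             + \<beta>\<^sup>2 / 2 * (pd_y h t y z)\<^sup>2 + \<beta>\<^sup>2 * c * \<gamma> = 0"
    unfolding L_def S[symmetric] switch_fun_def by (simp add: algebra_simps)
qed

end

section \<open>Terminal condition and regularity on the whole domain\<close>

lemma h_fun_terminal:
  assumes "z \<ge> 0"
  shows "h_fun T \<sigma> \<sigma>0 \<mu>0 \<gamma> c \<beta> T y z =
        - 1/2 * ln (z * \<sigma>0\<^sup>2 + 1)
        + (y\<^sup>2 * \<sigma>0\<^sup>2 + 2 * y * \<mu>0 - z * \<mu>0\<^sup>2) / (2 * (z * \<sigma>0\<^sup>2 + 1))"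
proof -
  define v where "v = z * \<sigma>0\<^sup>2 + 1"
  have v: "v > 0" using assms by (simp add: v_def add_nonneg_pos)
  have w: "w T z = v / \<sigma>0\<^sup>2" using pos by (simp add: w_def v_def field_simps)
  \<comment> \<open>At the terminal time the parabola criterion reads
    \<open>0 \<le> \<kappa> * w^2\<close>, so the upper branch applies and its term in
    \<open>T - t\<close> vanishes.\<close>
  have "u T z \<le> w T z" using u_le_w_iff[of T z] assms \<kappa>_pos by simp
  then have G: "G T z = - ln v / 2" using pos by (simp add: G_def G_up_def w)
  have "- \<mu>0\<^sup>2 / (2 * \<sigma>0\<^sup>2) + (\<mu>0 + \<sigma>0\<^sup>2 * y)\<^sup>2 / (2 * \<sigma>0^4 * w T z)
      = ((\<mu>0 + \<sigma>0\<^sup>2 * y)\<^sup>2 - \<mu>0\<^sup>2 * v) / \<sigma>0\<^sup>2 / (2 * v)"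
    unfolding w using pos v by (simp add: field_simps power2_eq_square power4_eq_xxxx)
  also have "((\<mu>0 + \<sigma>0\<^sup>2 * y)\<^sup>2 - \<mu>0\<^sup>2 * v) / \<sigma>0\<^sup>2 = y\<^sup>2 * \<sigma>0\<^sup>2 + 2 * y * \<mu>0 - z * \<mu>0\<^sup>2"
    unfolding v_def using pos by (simp add: field_simps power2_eq_square)
  finally show ?thesis
    using h_fun_eq[of T z y] assms pos unfolding G v_def[symmetric] by simp
qed

lemma continuous_on_wu:
  "continuous_on S (\<lambda>p. w (fst p) (snd (snd p)))"
  "continuous_on S (\<lambda>p. u (fst p) (snd (snd p)))"
  unfolding u_def quad_root_def w_def by (intro continuous_intros; use \<kappa>_pos in simp)+

lemma wu_pos_on_domain:
  assumes "p \<in> fb_domain T"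
  shows "w (fst p) (snd (snd p)) > 0" "u (fst p) (snd (snd p)) > 0"
  using assms w_pos u_pos by (auto simp: fb_domain_def)

lemma continuous_on_G:
  "continuous_on (fb_domain T) (\<lambda>p. G (fst p) (snd (snd p)))"
  "continuous_on (fb_domain T) (\<lambda>p. Gt (fst p) (snd (snd p)))"
  "continuous_on (fb_domain T) (\<lambda>p. Gz (fst p) (snd (snd p)))"
proof -
  note [continuous_intros] = continuous_on_wu
  have nz: "w (fst p) (snd (snd p)) \<noteq> 0" "u (fst p) (snd (snd p)) \<noteq> 0"
    if "p \<in> fb_domain T" for p
    using wu_pos_on_domain[OF that] by auto
  have dom: "fst p \<le> T" "snd (snd p) \<ge> 0" if "p \<in> fb_domain T" for p
    using that by (auto simp: fb_domain_def)
  show "continuous_on (fb_domain T) (\<lambda>p. G (fst p) (snd (snd p)))"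
    unfolding G_def
  proof (rule continuous_on_glue)
    show "continuous_on (fb_domain T) (\<lambda>p. G_up (fst p) (snd (snd p)))"
      unfolding G_up_def by (intro continuous_intros; use nz pos in auto)
    show "continuous_on (fb_domain T) (\<lambda>p. G_lo (fst p) (snd (snd p)))"
      unfolding G_lo_def by (intro continuous_intros; use nz pos in auto)
  qed (use G_match dom in \<open>auto intro!: continuous_intros\<close>)
  show "continuous_on (fb_domain T) (\<lambda>p. Gt (fst p) (snd (snd p)))"
    unfolding Gt_def
  proof (rule continuous_on_glue)
    fix p :: "real \<times> real \<times> real"
    assume "p \<in> fb_domain T" "w (fst p) (snd (snd p)) - u (fst p) (snd (snd p)) = 0"
    then show "a\<^sup>2 * (T - fst p) / (2 * (w (fst p) (snd (snd p)))\<^sup>2)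
      = a * c * \<gamma> + a * (a + \<beta>\<^sup>2) / (2 * \<beta>\<^sup>2)
        * (1 / w (fst p) (snd (snd p)) - 1 / u (fst p) (snd (snd p)))" by (intro Gt_match dom) auto
  qed (intro continuous_intros; use nz pos in auto)+
  show "continuous_on (fb_domain T) (\<lambda>p. Gz (fst p) (snd (snd p)))"
    unfolding Gz_def
  proof (rule continuous_on_glue)
    fix p :: "real \<times> real \<times> real"
    assume "p \<in> fb_domain T" "w (fst p) (snd (snd p)) - u (fst p) (snd (snd p)) = 0"
    then show "- 1 / (2 * w (fst p) (snd (snd p))) - a * (T - fst p) / (2 * (w (fst p) (snd (snd p)))\<^sup>2)
      = a / (2 * \<beta>\<^sup>2 * u (fst p) (snd (snd p))) - c * \<gamma>
        - (a + \<beta>\<^sup>2) / (2 * \<beta>\<^sup>2 * w (fst p) (snd (snd p)))" by (intro Gz_match dom) auto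
  qed (intro continuous_intros; use nz pos in auto)+
qed

text \<open>On the domain h and its partial derivatives coincide with explicit expressions in y,
  \<open>w\<close>, \<open>G\<close>, \<open>Gt\<close> and \<open>Gz\<close>, whose continuity is
  known and whose denominators do not vanish.\<close>

lemma C121_h_fun: "C121 T (h_fun T \<sigma> \<sigma>0 \<mu>0 \<gamma> c \<beta>)"
proof -
  note [continuous_intros] = continuous_on_wu continuous_on_G
  have nz: "w (fst p) (snd (snd p)) \<noteq> 0" if "p \<in> fb_domain T" for p
    using wu_pos_on_domain[OF that] by auto
  have dom: "0 \<le> fst p" "fst p \<le> T" "snd (snd p) \<ge> 0" if "p \<in> fb_domain T" for p
    using that by (auto simp: fb_domain_def)
  let ?h = "h_fun T \<sigma> \<sigma>0 \<mu>0 \<gamma> c \<beta>"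
  have "continuous_on (fb_domain T) (\<lambda>p. ?h (fst p) (fst (snd p)) (snd (snd p)))"
    by (subst continuous_on_cong[OF refl h_fun_eq[OF dom]], assumption)
      (intro continuous_intros; use nz pos in auto)
  moreover have "continuous_on (fb_domain T) (\<lambda>p. pd_t T ?h (fst p) (fst (snd p)) (snd (snd p)))"
    by (subst continuous_on_cong[OF refl pd_t_h_fun[OF dom]], assumption)
      (intro continuous_intros; use nz pos in auto)
  moreover have "continuous_on (fb_domain T) (\<lambda>p. pd_y ?h (fst p) (fst (snd p)) (snd (snd p)))"
    by (subst continuous_on_cong[OF refl pd_y_h_fun[OF dom]], assumption)
      (intro continuous_intros; use nz pos in auto)
  moreover have "continuous_on (fb_domain T) (\<lambda>p. pd_y (pd_y ?h) (fst p) (fst (snd p)) (snd (snd p)))"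
    by (subst continuous_on_cong[OF refl pd_yy_h_fun[OF dom]], assumption)
      (intro continuous_intros; use nz pos in auto)
  moreover have "continuous_on (fb_domain T) (\<lambda>p. pd_z ?h (fst p) (fst (snd p)) (snd (snd p)))"
    by (subst continuous_on_cong[OF refl pd_z_h_fun[OF dom]], assumption)
      (intro continuous_intros; use nz pos in auto)
  moreover have "(\<lambda>s. ?h s y z) differentiable (at t within {0..T}) \<and>
        (\<lambda>w. ?h t w z) differentiable (at y) \<and>
        (\<lambda>w. pd_y ?h t w z) differentiable (at y) \<and>
        (\<lambda>w. ?h t y w) differentiable (at z within {0..})" if "(t, y, z) \<in> fb_domain T" for t y z
    using dom[OF that] h_fun_has_t_derivative h_fun_has_y_derivative
      pd_y_h_fun_has_y_derivative h_fun_has_z_derivative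
    by (metis differentiableI_vector fst_conv snd_conv)
  ultimately show ?thesis unfolding C121_def by (auto simp: split_beta)
qed

lemma classical_solution_h_fun:
  "classical_solution T \<sigma> \<sigma>0 \<mu>0 \<gamma> c \<beta> (h_fun T \<sigma> \<sigma>0 \<mu>0 \<gamma> c \<beta>)"
  unfolding classical_solution_def
proof (intro conjI C121_h_fun allI impI h_fun_terminal ballI)
  fix p assume "p \<in> fb_domain T"
  then obtain t y z where p: "p = (t, y, z)" and "0 \<le> t" "t \<le> T" "0 \<le> z"
    by (auto simp: fb_domain_def)
  then show "case p of (t, y, z) \<Rightarrow>
        (switch_fun \<gamma> c (h_fun T \<sigma> \<sigma>0 \<mu>0 \<gamma> c \<beta>) t y z > 0 \<longrightarrow>
           pd_t T (h_fun T \<sigma> \<sigma>0 \<mu>0 \<gamma> c \<beta>) t y z + 1 / \<sigma>\<^sup>2 * (pd_z (h_fun T \<sigma> \<sigma>0 \<mu>0 \<gamma> c \<beta>) t y z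
             + 1/2 * pd_y (pd_y (h_fun T \<sigma> \<sigma>0 \<mu>0 \<gamma> c \<beta>)) t y z) = 0) \<and>
        (switch_fun \<gamma> c (h_fun T \<sigma> \<sigma>0 \<mu>0 \<gamma> c \<beta>) t y z \<le> 0 \<longrightarrow>
           pd_t T (h_fun T \<sigma> \<sigma>0 \<mu>0 \<gamma> c \<beta>) t y z
             + (1 / \<sigma>\<^sup>2 + \<beta>\<^sup>2) * (pd_z (h_fun T \<sigma> \<sigma>0 \<mu>0 \<gamma> c \<beta>) t y z
             + 1/2 * pd_y (pd_y (h_fun T \<sigma> \<sigma>0 \<mu>0 \<gamma> c \<beta>)) t y z)
             + \<beta>\<^sup>2 / 2 * (pd_y (h_fun T \<sigma> \<sigma>0 \<mu>0 \<gamma> c \<beta>) t y z)\<^sup>2 + \<beta>\<^sup>2 * c * \<gamma> = 0)"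
    using h_fun_pde[of t z y] unfolding p prod.case by blast
qed

section \<open>Identification of the free boundary\<close>

lemma free_boundary_h_fun:
  "free_boundary T \<gamma> c (h_fun T \<sigma> \<sigma>0 \<mu>0 \<gamma> c \<beta>) =
    {(t, y, z) \<in> fb_domain T. z = delta T \<sigma> \<sigma>0 \<gamma> c t}"
proof -
  define d where "d = delta T \<sigma> \<sigma>0 \<gamma> c"
  \<comment> \<open>Continuity on the whole line, beyond T by the odd extension of
    \<open>sqrt\<close>, makes the comparison sets closed in the full space before they are
    intersected with the domain.\<close>
  have d: "continuous_on UNIV d" unfolding d_def by (rule continuous_on_delta)
  let ?U = "{(t, y, z) \<in> fb_domain T. d t < z}"
  let ?L = "{(t, y, z) \<in> fb_domain T. z \<le> d t}"
  let ?U' = "{(t, y, z) \<in> fb_domain T. d t \<le> z}"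
  have U: "{(t, y, z) \<in> fb_domain T. switch_fun \<gamma> c (h_fun T \<sigma> \<sigma>0 \<mu>0 \<gamma> c \<beta>) t y z > 0} = ?U"
    using switch_pos_iff by (auto simp: fb_domain_def d_def)
  have L: "{(t, y, z) \<in> fb_domain T. switch_fun \<gamma> c (h_fun T \<sigma> \<sigma>0 \<mu>0 \<gamma> c \<beta>) t y z \<le> 0} = ?L"
    using switch_pos_iff by (auto simp: fb_domain_def d_def not_less[symmetric])
  have dp: "continuous_on UNIV (\<lambda>p::real \<times> real \<times> real. d (fst p))"
    by (rule continuous_on_compose2[OF d]) (auto intro!: continuous_intros)
  have dom: "closed (fb_domain T)"
    unfolding fb_domain_def by (intro closed_Times) auto
  have clL: "closed ?L"
  proof -
    have "?L = fb_domain T \<inter> {p. snd (snd p) \<le> d (fst p)}" by auto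
    moreover have "closed {p::real \<times> real \<times> real. snd (snd p) \<le> d (fst p)}"
      by (intro closed_Collect_le dp continuous_intros)
    ultimately show ?thesis using dom by (simp add: closed_Int)
  qed
  have clU: "closed ?U'"
  proof -
    have "?U' = fb_domain T \<inter> {p. d (fst p) \<le> snd (snd p)}" by auto
    moreover have "closed {p::real \<times> real \<times> real. d (fst p) \<le> snd (snd p)}"
      by (intro closed_Collect_le dp continuous_intros)
    ultimately show ?thesis using dom by (simp add: closed_Int)
  qed
  have "closure ?U \<subseteq> ?U'" by (rule closure_minimal[OF _ clU]) auto
  moreover have "p \<in> closure ?U" if "p \<in> ?L" "p \<in> ?U'" for p
  proof -
    obtain t y z where p: "p = (t, y, z)" by (cases p)
    then have z: "(t, y, z) \<in> fb_domain T" "z = d t" using that by auto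
    \<comment> \<open>A point of the curve is approached from the open side by raising z, which
      never leaves the domain.\<close>
    have "(\<lambda>n. (t, y, z + inverse (real (Suc n)))) \<longlonglongrightarrow> (t, y, z + 0)"
      by (intro tendsto_intros LIMSEQ_inverse_real_of_nat)
    moreover have "(t, y, z + inverse (real (Suc n))) \<in> ?U" for n
      using z by (auto simp: fb_domain_def intro: add_nonneg_nonneg)
    ultimately show ?thesis unfolding closure_sequential p
      by (intro exI[of _ "\<lambda>n. (t, y, z + inverse (real (Suc n)))"]) simp
  qed
  ultimately have "closure ?U \<inter> closure ?L = ?L \<inter> ?U'" using clL by auto
  then show ?thesis unfolding free_boundary_def U L d_def by auto
qed

end

theorem theorem4p2:
  fixes T \<sigma> \<sigma>0 \<mu>0 \<gamma> c \<beta> :: real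
  assumes "T > 0" and "\<sigma> > 0" and "\<sigma>0 > 0" and "\<gamma> > 0" and "c > 0" and "\<beta> > 0"
  shows "(\<forall>t z. 0 \<le> t \<and> t \<le> T \<and> 0 \<le> z \<and> z < delta T \<sigma> \<sigma>0 \<gamma> c t \<longrightarrow>
            (\<exists>!s. is_t1 T \<sigma> \<sigma>0 \<gamma> c \<beta> t z s))
    \<and> (\<forall>t z. 0 \<le> t \<and> t \<le> T \<and> 0 \<le> z \<and> z < delta T \<sigma> \<sigma>0 \<gamma> c t \<longrightarrow>
         (let t1 = t1_fun T \<sigma> \<sigma>0 \<gamma> c \<beta> t z; d1 = delta T \<sigma> \<sigma>0 \<gamma> c t1 in
            P_fun T \<sigma> \<sigma>0 \<mu>0 \<gamma> c \<beta> t z =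
              P_fun T \<sigma> \<sigma>0 \<mu>0 \<gamma> c \<beta> t1 d1 + \<beta>\<^sup>2 * c * \<gamma> * (t1 - t)
              - \<mu>0\<^sup>2 / (2 * \<sigma>0\<^sup>2) * (H_fun T \<sigma> \<sigma>0 t1 d1 - H_fun T \<sigma> \<sigma>0 t z)
              - (\<beta>\<^sup>2 + 1 / \<sigma>\<^sup>2) / (2 * \<beta>\<^sup>2)
                * (ln (H_fun T \<sigma> \<sigma>0 t1 d1) - ln (H_fun T \<sigma> \<sigma>0 t z))))
    \<and> classical_solution T \<sigma> \<sigma>0 \<mu>0 \<gamma> c \<beta> (h_fun T \<sigma> \<sigma>0 \<mu>0 \<gamma> c \<beta>)
    \<and> free_boundary T \<gamma> c (h_fun T \<sigma> \<sigma>0 \<mu>0 \<gamma> c \<beta>) =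
        {(t, y, z) \<in> fb_domain T. z = delta T \<sigma> \<sigma>0 \<gamma> c t}"
proof -
  interpret free_boundary_problem T \<sigma> \<sigma>0 \<mu>0 \<gamma> c \<beta>
    using assms by unfold_locales
  show ?thesis
  proof (intro conjI allI impI; (elim conjE)?)
    fix t z
    assume t: "0 \<le> t" "t \<le> T" and z: "0 \<le> z" "z < delta T \<sigma> \<sigma>0 \<gamma> c t"
    show "\<exists>!s. is_t1 T \<sigma> \<sigma>0 \<gamma> c \<beta> t z s"
      using below_boundary(2)[OF t z refl] by simp
  qed (rule P_fun_below_boundary classical_solution_h_fun free_boundary_h_fun; assumption)+
qed

end
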